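(* For every positive integer $d$ and all positive real numbers $\varepsilon$ and $\delta$ with $\varepsilon<\frac12$, there is a positive constant $K=K(\varepsilon,\delta,d)$ such that the following holds. Let $Y$ be a sequence of $N$ independent $\mathrm{Ber}(p)$ random variables for some $p\in(0,1/2)$ and assume that $X=X(Y)$ is nonnegative with complexity at most $d$ and satisfies $\Phi_X(\delta-\varepsilon)\ge K\log(1/p)$. Let $\mathcal{F}$ be the collection of all subcubes $F\subseteq\{0,1\}^N$ satisfying (1) $\mathbb{E}_F[X]\ge(1+\delta-\varepsilon)\mathbb{E}[X]$ and (2) $\mathrm{codim}(F)\le K\cdot\Phi_X(\delta+\varepsilon)$. Then \[ \mathbb{P}(X\ge(1+\delta)\mathbb{E}[X])\le(1+\varepsilon)\,\mathbb{P}(Y\in F\text{ for some }F\in\mathcal{F}). \]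
   Context: For $I\subseteq[N]$ and $x\in\{0,1\}^N$, the subcube centered at $(I,x)$ is $F(I,x)=\{y\in\{0,1\}^N: y_i=x_i\ \forall i\in I\}$; its codimension is $\mathrm{codim}(F)=|I|$ (well defined). For $X:\{0,1\}^N\to\mathbb{R}_{\ge0}$, the complexity of $X$ is the smallest integer $d$ such that $X$ is a linear combination with nonnegative coefficients of indicator functions of subcubes of codimension at most $d$. With $Y$ a random element of $\{0,1\}^N$ and $X=X(Y)$, for a subcube $F$ write $\mathbb{E}_F[X]=\mathbb{E}[X\mid Y\in F]$, and define $\Phi_X(t)=\min\{-\log\mathbb{P}(Y\in F): F\subseteq\{0,1\}^N \text{ a subcube with } \mathbb{E}_F[X]\ge(1+t)\mathbb{E}[X]\}$ (minimum of the empty set is $+\infty$). *)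

theory Defs
  imports "HOL-Probability.Probability"
begin

text \<open>The coordinates 0 and 1 are represented by \<^const>\<open>False\<close> and \<^const>\<open>True\<close>, and a point
  of \<open>{0,1}\<^sup>N\<close> by a function that is constantly \<^const>\<open>False\<close> outside \<open>{1..N}\<close>. With this
  convention each point has exactly one representative, and the law of a random point is a
  \<^const>\<open>Pi_pmf\<close> with default value \<^const>\<open>False\<close>.\<close>

definition cube :: "nat \<Rightarrow> (nat \<Rightarrow> bool) set" where
  "cube N = PiE_dflt {1..N} False (\<lambda>_. UNIV)"

definition subcube :: "nat \<Rightarrow> nat set \<Rightarrow> (nat \<Rightarrow> bool) \<Rightarrow> (nat \<Rightarrow> bool) set" where
  "subcube N I x = {y \<in> cube N. \<forall>i\<in>I. y i = x i}"

definition subcubes :: "nat \<Rightarrow> (nat \<Rightarrow> bool) set set" where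
  "subcubes N = {subcube N I x | I x. I \<subseteq> {1..N} \<and> x \<in> cube N}"

definition codim :: "nat \<Rightarrow> (nat \<Rightarrow> bool) set \<Rightarrow> nat" where
  "codim N F = (THE k. \<exists>I x. I \<subseteq> {1..N} \<and> x \<in> cube N \<and> F = subcube N I x \<and> k = card I)"

text \<open>The set of \<open>d\<close> below is nonempty for every \<open>X\<close> that is nonnegative on the cube, because the
  points are the subcubes of codimension \<open>N\<close>; see \<open>complexity_attained\<close>.\<close>

definition complexity :: "nat \<Rightarrow> ((nat \<Rightarrow> bool) \<Rightarrow> real) \<Rightarrow> nat" where
  "complexity N X = (LEAST d. \<exists>c. (\<forall>F. 0 \<le> c F) \<and>
     (\<forall>y \<in> cube N. X y = (\<Sum>F | F \<in> subcubes N \<and> codim N F \<le> d. c F * indicator F y)))"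

definition cond_mean :: "(nat \<Rightarrow> bool) pmf \<Rightarrow> (nat \<Rightarrow> bool) set \<Rightarrow> ((nat \<Rightarrow> bool) \<Rightarrow> real) \<Rightarrow> real" where
  "cond_mean D F X = measure_pmf.expectation (cond_pmf D F) X"

text \<open>Here \<open>D\<close> is the law of the random point \<open>Y\<close>. Subcubes of probability 0, for which the
  conditional expectation is undefined, are left out. The infimum is over a finite set, hence
  is a minimum if that set is nonempty, and is \<open>\<infinity>\<close> otherwise.\<close>

definition Phi :: "nat \<Rightarrow> (nat \<Rightarrow> bool) pmf \<Rightarrow> ((nat \<Rightarrow> bool) \<Rightarrow> real) \<Rightarrow> real \<Rightarrow> ereal" where
  "Phi N D X t = Inf {ereal (- ln (measure_pmf.prob D F)) | F.
     F \<in> subcubes N \<and> measure_pmf.prob D F > 0 \<and>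
     cond_mean D F X \<ge> (1 + t) * measure_pmf.expectation D X}"

definition bernoulli_cube :: "nat \<Rightarrow> real \<Rightarrow> (nat \<Rightarrow> bool) pmf" where
  "bernoulli_cube N p = Pi_pmf {1..N} False (\<lambda>_. bernoulli_pmf p)"


lemma mem_cube_iff: "y \<in> cube N \<longleftrightarrow> (\<forall>i. i \<notin> {1..N} \<longrightarrow> \<not> y i)"
  by (auto simp: cube_def PiE_dflt_def)

lemma finite_cube: "finite (cube N)"
  unfolding cube_def by (rule finite_PiE_dflt) auto

lemma subcube_eqD:
  assumes I: "I \<subseteq> {1..N}" "x \<in> cube N" and eq: "subcube N I x = subcube N J y"
  shows "J \<subseteq> I \<union> - {1..N}"
proof
  fix i assume "i \<in> J"
  show "i \<in> I \<union> - {1..N}"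
  proof (rule ccontr)
    assume i: "i \<notin> I \<union> - {1..N}"
    have "x(i := b) \<in> subcube N I x" for b
      using i I by (auto simp: subcube_def mem_cube_iff)
    then have "x(i := b) \<in> subcube N J y" for b
      unfolding eq .
    then have "b = y i" for b
      using \<open>i \<in> J\<close> unfolding subcube_def by fastforce
    from this[of True] this[of False] show False by simp
  qed
qed

lemma codim_subcube:
  assumes "I \<subseteq> {1..N}" "x \<in> cube N"
  shows "codim N (subcube N I x) = card I"
  unfolding codim_def
proof (rule the_equality)
  show "\<exists>J y. J \<subseteq> {1..N} \<and> y \<in> cube N \<and> subcube N I x = subcube N J y \<and> card I = card J"
    using assms by blast
next
  fix k assume "\<exists>J y. J \<subseteq> {1..N} \<and> y \<in> cube N \<and> subcube N I x = subcube N J y \<and> k = card J"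
  then obtain J y where J: "J \<subseteq> {1..N}" "y \<in> cube N" "subcube N I x = subcube N J y" "k = card J"
    by blast
  from subcube_eqD[OF assms J(3)] subcube_eqD[OF J(1,2) J(3)[symmetric]] assms(1) J(1)
  have "I = J" by blast
  with J(4) show "k = card I" by simp
qed

lemma finite_subcubes: "finite (subcubes N)"
proof (rule finite_subset)
  show "subcubes N \<subseteq> Pow (cube N)" by (auto simp: subcubes_def subcube_def)
qed (simp add: finite_cube)

lemma subcube_full:
  assumes "x \<in> cube N"
  shows "subcube N {1..N} x = {x}"
proof -
  have "y = x" if "y \<in> subcube N {1..N} x" for y
  proof
    fix i
    show "y i = x i"
    proof (cases "i \<in> {1..N}")
      case True
      then show ?thesis using that by (simp add: subcube_def)
    next
      case False
      then show ?thesis using that assms unfolding subcube_def mem_cube_iff by blast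
    qed
  qed
  moreover have "x \<in> subcube N {1..N} x" using assms by (simp add: subcube_def)
  ultimately show ?thesis by blast
qed

lemma complexity_attained:
  assumes "\<forall>y \<in> cube N. 0 \<le> X y"
  shows "\<exists>c. (\<forall>F. 0 \<le> c F) \<and> (\<forall>y \<in> cube N.
    X y = (\<Sum>F | F \<in> subcubes N \<and> codim N F \<le> complexity N X. c F * indicator F y))"
  unfolding complexity_def
proof (rule LeastI_ex, intro exI conjI ballI allI)
  define c where "c F = (if F \<in> (\<lambda>y. {y}) ` cube N then X (the_elem F) else 0)" for F
  show "0 \<le> c F" for F using assms by (auto simp: c_def)
  fix y assume y: "y \<in> cube N"
  let ?A = "{F. F \<in> subcubes N \<and> codim N F \<le> N}"
  have "{y} \<in> ?A"
    using codim_subcube[of "{1..N}" N y] subcube_full[OF y] y by (auto simp: subcubes_def)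
  moreover have "finite ?A" using finite_subcubes by simp
  moreover have "c F * indicator F y = 0" if "F \<noteq> {y}" for F
    using that by (auto simp: c_def indicator_def)
  ultimately have "(\<Sum>F\<in>?A. c F * indicator F y) = (\<Sum>F\<in>{{y}}. c F * indicator F y)"
    by (intro sum.mono_neutral_right) auto
  also have "\<dots> = X y" using y by (simp add: c_def)
  finally show "X y = (\<Sum>F\<in>?A. c F * indicator F y)" by simp
qed

end

theory Submission
  imports Defs
begin

text \<open>Write \<open>\<mu> = E X\<close>, let \<open>Z\<close> be the event that \<open>Y\<close> lies in no member of \<open>\<F>\<close>, and expand
  \<open>E[X\<^sup>l 1\<^sub>Z]\<close> by revealing the \<open>l\<close> subcubes of a product one at a time. If the intersection
  \<open>G\<close> of the revealed ones meets \<open>Z\<close>, it is not in \<open>\<F>\<close>; if its codimension is small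
  enough, this forces \<open>E\<^sub>G X < (1 + \<delta> - \<epsilon>) \<mu>\<close>. Hence \<open>E[X\<^sup>l 1\<^sub>Z] \<le> ((1 + \<delta> - \<epsilon>) \<mu>)\<^sup>l\<close> whenever
  \<open>d l \<le> K \<Phi>(\<delta> + \<epsilon>)\<close>, and Markov's inequality makes \<open>P(X \<ge> (1 + \<delta>) \<mu>, Z)\<close> smaller than
  \<open>exp (- 2 \<Phi>(\<delta> + \<epsilon>))\<close> by any constant factor. On the other hand \<open>X \<le> \<mu> / p\<^sup>d\<close> on the cube, so
  conditioning on a subcube that attains \<open>\<Phi>(\<delta> + \<epsilon>)\<close> gives
  \<open>P(X \<ge> (1 + \<delta>) \<mu>) \<ge> \<epsilon> p\<^sup>d exp (- \<Phi>(\<delta> + \<epsilon>)) \<ge> \<epsilon> exp (- 2 \<Phi>(\<delta> + \<epsilon>))\<close>.\<close>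

section \<open>Expectations over laws of finite support\<close>

lemma expectation_mono_finite:
  fixes f g :: "'a \<Rightarrow> real"
  assumes "finite (set_pmf D)" and "\<And>y. y \<in> set_pmf D \<Longrightarrow> f y \<le> g y"
  shows "measure_pmf.expectation D f \<le> measure_pmf.expectation D g"
  using assms by (intro integral_mono_AE integrable_measure_pmf_finite) (auto simp: AE_measure_pmf_iff)

lemma expectation_cong_pmf:
  fixes f g :: "'a \<Rightarrow> real"
  assumes "\<And>y. y \<in> set_pmf D \<Longrightarrow> f y = g y"
  shows "measure_pmf.expectation D f = measure_pmf.expectation D g"
  using assms by (intro integral_cong_AE) (auto simp: AE_measure_pmf_iff)

lemma cond_mean_mult_prob:
  assumes fin: "finite (set_pmf D)" and pos: "measure_pmf.prob D F > 0"
  shows "cond_mean D F X * measure_pmf.prob D F = measure_pmf.expectation D (\<lambda>y. indicator F y * X y)"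
proof -
  have ne: "set_pmf D \<inter> F \<noteq> {}"
    using pos by (metis Int_commute measure_Int_set_pmf measure_empty less_irrefl)
  have "cond_mean D F X = (\<Sum>y\<in>set_pmf D. X y * pmf (cond_pmf D F) y)"
    unfolding cond_mean_def using fin set_cond_pmf[OF ne]
    by (intro integral_measure_pmf_real) auto
  also have "\<dots> = (\<Sum>y\<in>set_pmf D. indicator F y * X y * pmf D y / measure_pmf.prob D F)"
    by (intro sum.cong) (auto simp: pmf_cond[OF ne])
  finally have "cond_mean D F X * measure_pmf.prob D F
      = (\<Sum>y\<in>set_pmf D. indicator F y * X y * pmf D y)"
    using pos by (simp add: sum_divide_distrib[symmetric])
  also have "\<dots> = measure_pmf.expectation D (\<lambda>y. indicator F y * X y)"
    using fin by (intro integral_measure_pmf_real[symmetric]) auto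
  finally show ?thesis .
qed

text \<open>Markov's inequality without division. The bound \<open>t \<le> f y\<close> is asked only
  on \<open>S\<close>, so that \<open>f\<close> may carry the indicator of \<open>- B\<close> when
  \<open>S\<close> avoids \<open>B\<close>.\<close>

lemma prob_mult_le_expectation:
  fixes f :: "'a \<Rightarrow> real"
  assumes fin: "finite (set_pmf D)" and "\<And>y. y \<in> set_pmf D \<Longrightarrow> 0 \<le> f y"
    and "\<And>y. y \<in> set_pmf D \<Longrightarrow> y \<in> S \<Longrightarrow> t \<le> f y"
  shows "t * measure_pmf.prob D S \<le> measure_pmf.expectation D f"
proof -
  have "t * measure_pmf.prob D S = measure_pmf.expectation D (\<lambda>y. t * indicator S y)"
    by simp
  also have "\<dots> \<le> measure_pmf.expectation D f"
    using assms by (intro expectation_mono_finite) (auto simp: indicator_def)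
  finally show ?thesis .
qed

section \<open>Intersections of subcubes and the truncated moment\<close>

text \<open>Any common point can serve as center of both subcubes, so intersecting just unites the
  sets of fixed coordinates. These may overlap, hence only an inequality.\<close>

lemma subcube_Int:
  assumes "F \<in> subcubes N" "G \<in> subcubes N" "F \<inter> G \<noteq> {}"
  shows "F \<inter> G \<in> subcubes N" and "codim N (F \<inter> G) \<le> codim N F + codim N G"
proof -
  obtain I x where F: "I \<subseteq> {1..N}" "x \<in> cube N" "F = subcube N I x"
    using assms(1) by (auto simp: subcubes_def)
  obtain J y where G: "J \<subseteq> {1..N}" "y \<in> cube N" "G = subcube N J y"
    using assms(2) by (auto simp: subcubes_def)
  obtain z where z: "z \<in> F" "z \<in> G" using assms(3) by blast
  have eq: "F \<inter> G = subcube N (I \<union> J) z"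
    using z unfolding F(3) G(3) by (auto simp: subcube_def)
  have zc: "z \<in> cube N" and IJ: "I \<union> J \<subseteq> {1..N}"
    using z F G by (auto simp: subcube_def)
  show "F \<inter> G \<in> subcubes N" unfolding subcubes_def eq using zc IJ by blast
  show "codim N (F \<inter> G) \<le> codim N F + codim N G"
    unfolding eq codim_subcube[OF IJ zc] unfolding F(3) G(3) codim_subcube[OF F(1,2)] codim_subcube[OF G(1,2)]
    by (rule card_Un_le)
qed

text \<open>Induction on \<open>k\<close>, peeling off one factor \<open>X\<close> as a combination
  of indicators. Passing from \<open>G\<close> to \<open>F \<inter> G\<close> costs at most
  \<open>d\<close> in codimension, which the budget \<open>codim N G + d * k \<le> M\<close> covers.
  The hypothesis on \<open>B\<close> acts through its contrapositive: a \<open>G\<close> of positive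
  probability within budget that is not swallowed by \<open>B\<close> has conditional mean below
  \<open>A\<close>.\<close>

lemma truncated_moment_le:
  assumes fin: "finite (set_pmf D)" and T: "finite T" "T \<subseteq> subcubes N"
    and d: "\<And>F. F \<in> T \<Longrightarrow> codim N F \<le> d"
    and c: "\<And>F. 0 \<le> c F"
    and X: "\<And>y. y \<in> set_pmf D \<Longrightarrow> X y = (\<Sum>F\<in>T. c F * indicator F y)"
    and A: "0 \<le> A"
    and B: "\<And>G. G \<in> subcubes N \<Longrightarrow> codim N G \<le> M \<Longrightarrow> measure_pmf.prob D G > 0 \<Longrightarrow>
              A \<le> cond_mean D G X \<Longrightarrow> G \<subseteq> B"
    and "G \<in> subcubes N" "codim N G + d * k \<le> M"
  shows "measure_pmf.expectation D (\<lambda>y. indicator G y * X y ^ k * indicator (- B) y)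
           \<le> measure_pmf.prob D G * A ^ k"
  using assms(9,10)
proof (induction k arbitrary: G)
  case 0
  have "measure_pmf.expectation D (\<lambda>y. indicator G y * X y ^ 0 * indicator (- B) y)
      \<le> measure_pmf.expectation D (indicator G :: _ \<Rightarrow> real)"
    using fin by (intro expectation_mono_finite) (auto simp: indicator_def)
  then show ?case by simp
next
  case (Suc k)
  note [simp] = integrable_measure_pmf_finite[OF fin]
  let ?P = "measure_pmf.prob D" and ?E = "measure_pmf.expectation D"
  \<comment> \<open>In the degenerate case the integrand vanishes almost surely, so no bound on the
    conditional mean is wanted.\<close>
  show ?case
  proof (cases "?P G > 0 \<and> \<not> G \<subseteq> B")
    case False
    then have "?P G = 0 \<or> G \<subseteq> B" by (auto simp: zero_less_measure_iff)
    then have "?E (\<lambda>y. indicator G y * X y ^ Suc k * indicator (- B) y) = 0"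
    proof
      assume "?P G = 0"
      then have "y \<notin> G" if "y \<in> set_pmf D" for y
        using that by (simp add: measure_pmf_zero_iff disjoint_iff)
      then show ?thesis using expectation_cong_pmf[of D _ "\<lambda>_. 0"] by simp
    next
      assume "G \<subseteq> B"
      then have "(\<lambda>y. indicator G y * X y ^ Suc k * indicator (- B) y) = (\<lambda>y. 0 :: real)"
        by (auto simp: indicator_def fun_eq_iff)
      then show ?thesis by simp
    qed
    with A show ?thesis by simp
  next
    case True
    have lt: "cond_mean D G X < A"
      using B[OF Suc.prems(1)] Suc.prems(2) True by fastforce
    have "?E (\<lambda>y. indicator G y * X y ^ Suc k * indicator (- B) y)
        = ?E (\<lambda>y. \<Sum>F\<in>T. c F * (indicator (F \<inter> G) y * X y ^ k * indicator (- B) y))"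
    proof (rule expectation_cong_pmf)
      fix y assume "y \<in> set_pmf D"
      from X[OF this] have "indicator G y * X y ^ Suc k * indicator (- B) y
          = indicator G y * (\<Sum>F\<in>T. c F * indicator F y) * X y ^ k * indicator (- B) y"
        by simp
      then show "indicator G y * X y ^ Suc k * indicator (- B) y
          = (\<Sum>F\<in>T. c F * (indicator (F \<inter> G) y * X y ^ k * indicator (- B) y))"
        by (simp add: sum_distrib_left sum_distrib_right indicator_inter_arith mult_ac)
    qed
    also have "\<dots> = (\<Sum>F\<in>T. c F * ?E (\<lambda>y. indicator (F \<inter> G) y * X y ^ k * indicator (- B) y))"
      by simp
    also have "\<dots> \<le> (\<Sum>F\<in>T. c F * (?P (F \<inter> G) * A ^ k))"
    proof (intro sum_mono mult_left_mono c)
      fix F assume F: "F \<in> T"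
      show "?E (\<lambda>y. indicator (F \<inter> G) y * X y ^ k * indicator (- B) y) \<le> ?P (F \<inter> G) * A ^ k"
      proof (cases "F \<inter> G = {}")
        case False
        have FG: "F \<inter> G \<in> subcubes N" "codim N (F \<inter> G) \<le> codim N F + codim N G"
          using subcube_Int[OF _ Suc.prems(1) False] F T by auto
        then show ?thesis
          using Suc.prems(2) d[OF F] by (intro Suc.IH) auto
      qed simp
    qed
    also have "\<dots> = A ^ k * ?E (\<lambda>y. \<Sum>F\<in>T. c F * indicator (F \<inter> G) y)"
      by (simp add: sum_distrib_left mult_ac)
    \<comment> \<open>After the induction hypothesis has removed the other \<open>k\<close> factors,
      the sum over \<open>F\<close> reassembles to a single \<open>X\<close> on \<open>G\<close>,
      whose mean is controlled by \<open>lt\<close>.\<close>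
    also have "?E (\<lambda>y. \<Sum>F\<in>T. c F * indicator (F \<inter> G) y) = ?E (\<lambda>y. indicator G y * X y)"
      by (rule expectation_cong_pmf)
        (simp add: X indicator_inter_arith sum_distrib_left mult_ac)
    also have "\<dots> = cond_mean D G X * ?P G"
      using cond_mean_mult_prob[OF fin] True by simp
    also have "A ^ k * (cond_mean D G X * ?P G) \<le> A ^ k * (A * ?P G)"
      using lt A by (intro mult_left_mono mult_right_mono) auto
    finally show ?thesis by (simp add: mult_ac)
  qed
qed

section \<open>Subcubes under the Bernoulli law\<close>

lemma set_pmf_bernoulli_cube:
  assumes "0 < p" "p < 1"
  shows "set_pmf (bernoulli_cube N p) = cube N"
  using assms by (simp add: bernoulli_cube_def set_Pi_pmf cube_def set_pmf_bernoulli comp_def)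

text \<open>A subcube is a product set, and each fixed coordinate contributes \<open>p\<close> or
  \<open>1 - p\<close>, both at least \<open>p\<close> because \<open>p < 1 / 2\<close>.\<close>

lemma prob_subcube_ge:
  assumes p: "0 < p" "p < 1 / 2" and F: "F \<in> subcubes N"
  shows "p ^ codim N F \<le> measure_pmf.prob (bernoulli_cube N p) F"
proof -
  obtain I x where I: "I \<subseteq> {1..N}" "x \<in> cube N" "F = subcube N I x"
    using F by (auto simp: subcubes_def)
  have eq: "F = PiE_dflt {1..N} False (\<lambda>i. if i \<in> I then {x i} else UNIV)"
    using I(1) unfolding I(3) subcube_def cube_def PiE_dflt_def by (auto split: if_splits)
  have "p ^ codim N F = (\<Prod>i\<in>I. p)"
    using I codim_subcube by simp
  also have "\<dots> = (\<Prod>i\<in>{1..N}. if i \<in> I then p else 1)"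
    using I(1) by (simp add: prod.If_cases Int_absorb1)
  also have "\<dots> \<le> (\<Prod>i\<in>{1..N}. measure_pmf.prob (bernoulli_pmf p) (if i \<in> I then {x i} else UNIV))"
  proof (intro prod_mono conjI)
    fix i
    show "(if i \<in> I then p else 1) \<le> measure_pmf.prob (bernoulli_pmf p) (if i \<in> I then {x i} else UNIV)"
      using p by (cases "x i") (auto simp: measure_pmf_single)
  qed (use p in auto)
  also have "\<dots> = measure_pmf.prob (bernoulli_cube N p) F"
    unfolding eq bernoulli_cube_def by (simp add: measure_Pi_pmf_PiE_dflt)
  finally show ?thesis .
qed

lemma prob_subcube_pos:
  assumes "0 < p" "p < 1 / 2" "F \<in> subcubes N"
  shows "0 < measure_pmf.prob (bernoulli_cube N p) F"
  using prob_subcube_ge[OF assms] assms(1) by (meson less_le_trans zero_less_power)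

text \<open>Termwise comparison: every \<open>F\<close> in the expansion has probability at least
  \<open>p ^ d\<close>, while its indicator is at most 1.\<close>

lemma max_le_expectation:
  assumes p: "0 < p" "p < 1 / 2" and T: "finite T" "T \<subseteq> subcubes N"
    and d: "\<And>F. F \<in> T \<Longrightarrow> codim N F \<le> d"
    and c: "\<And>F. 0 \<le> c F"
    and X: "\<And>y. y \<in> cube N \<Longrightarrow> X y = (\<Sum>F\<in>T. c F * indicator F y)"
    and y: "y \<in> cube N"
  shows "p ^ d * X y \<le> measure_pmf.expectation (bernoulli_cube N p) X"
proof -
  let ?D = "bernoulli_cube N p"
  have S: "set_pmf ?D = cube N" using p by (intro set_pmf_bernoulli_cube) auto
  then have fin: "finite (set_pmf ?D)" by (simp add: finite_cube)
  note [simp] = integrable_measure_pmf_finite[OF fin]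
  have "p ^ d * X y = (\<Sum>F\<in>T. c F * (indicator F y * p ^ d))"
    by (simp add: X[OF y] sum_distrib_left mult_ac)
  also have "\<dots> \<le> (\<Sum>F\<in>T. c F * measure_pmf.prob ?D F)"
  proof (intro sum_mono mult_left_mono c)
    fix F assume F: "F \<in> T"
    have "indicator F y * p ^ d \<le> p ^ d" using p by (auto simp: indicator_def)
    also have "\<dots> \<le> p ^ codim N F" using p d[OF F] by (intro power_decreasing) auto
    also have "\<dots> \<le> measure_pmf.prob ?D F" using F T p by (intro prob_subcube_ge) auto
    finally show "indicator F y * p ^ d \<le> measure_pmf.prob ?D F" .
  qed
  also have "\<dots> = measure_pmf.expectation ?D (\<lambda>y. \<Sum>F\<in>T. c F * indicator F y)"
    by simp
  also have "\<dots> = measure_pmf.expectation ?D X"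
    by (rule expectation_cong_pmf) (simp add: S X)
  finally show ?thesis .
qed

section \<open>The function \<open>Phi\<close>\<close>

text \<open>There are finitely many subcubes, so a nonempty infimum is a minimum; an empty one would
  be infinite.\<close>

lemma Phi_attained:
  assumes "Phi N D X t \<noteq> \<infinity>"
  obtains F where "F \<in> subcubes N" "measure_pmf.prob D F > 0"
    "cond_mean D F X \<ge> (1 + t) * measure_pmf.expectation D X"
    "Phi N D X t = ereal (- ln (measure_pmf.prob D F))"
proof -
  let ?S = "{ereal (- ln (measure_pmf.prob D F)) | F.
     F \<in> subcubes N \<and> measure_pmf.prob D F > 0 \<and>
     cond_mean D F X \<ge> (1 + t) * measure_pmf.expectation D X}"
  have ne: "?S \<noteq> {}"
  proof
    assume e: "?S = {}"
    show False using assms unfolding Phi_def e by (simp add: top_ereal_def)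
  qed
  have fin: "finite ?S"
    by (rule finite_subset[of _ "(\<lambda>F. ereal (- ln (measure_pmf.prob D F))) ` subcubes N"])
      (auto simp: finite_subcubes)
  have "Phi N D X t \<in> ?S"
    unfolding Phi_def cInf_eq_Min[OF fin ne] using Min_in[OF fin ne] .
  then show thesis using that by blast
qed

lemma Phi_le:
  assumes "F \<in> subcubes N" "measure_pmf.prob D F > 0"
    "cond_mean D F X \<ge> (1 + t) * measure_pmf.expectation D X"
  shows "Phi N D X t \<le> ereal (- ln (measure_pmf.prob D F))"
  unfolding Phi_def using assms by (intro Inf_lower) blast

lemma Phi_mono:
  assumes "s \<le> t" "0 \<le> measure_pmf.expectation D X"
  shows "Phi N D X s \<le> Phi N D X t"
  unfolding Phi_def
proof (rule Inf_superset_mono, safe)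
  fix F assume "F \<in> subcubes N" "0 < measure_pmf.prob D F"
    "(1 + t) * measure_pmf.expectation D X \<le> cond_mean D F X"
  moreover have "(1 + s) * measure_pmf.expectation D X \<le> (1 + t) * measure_pmf.expectation D X"
    using assms by (intro mult_right_mono) auto
  ultimately show "\<exists>F'. ereal (- ln (measure_pmf.prob D F)) = ereal (- ln (measure_pmf.prob D F')) \<and>
     F' \<in> subcubes N \<and> 0 < measure_pmf.prob D F' \<and>
     (1 + s) * measure_pmf.expectation D X \<le> cond_mean D F' X"
    by (intro exI[of _ F]) auto
qed

lemma cube_in_subcubes: "cube N \<in> subcubes N" and codim_cube: "codim N (cube N) = 0"
proof -
  have x: "(\<lambda>_. False) \<in> cube N" by (simp add: mem_cube_iff)
  have eq: "cube N = subcube N {} (\<lambda>_. False)" by (simp add: subcube_def)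
  show "cube N \<in> subcubes N" using x eq unfolding subcubes_def by blast
  show "codim N (cube N) = 0"
    using codim_subcube[of "{}" N, OF _ x] eq by simp
qed

lemma singleton_in_subcubes:
  assumes "y \<in> cube N"
  shows "{y} \<in> subcubes N"
  using subcube_full[OF assms] assms unfolding subcubes_def by blast

section \<open>Estimates of the tail and of the decay rate\<close>

text \<open>A reverse Markov bound: on \<open>F\<close>, the variable is below \<open>t * m\<close>
  off the tail event and at most \<open>m / q\<close> on it, so the excess \<open>s * m\<close> of
  the mean must come from the tail. It is applied with \<open>t = 1 + \<delta>\<close>,
  \<open>s = \<epsilon>\<close>, \<open>q = p ^ d\<close>.\<close>

lemma upper_tail_ge:
  assumes fin: "finite (set_pmf D)" and F: "measure_pmf.prob D F > 0"
    and mean: "(t + s) * m \<le> cond_mean D F X"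
    and X: "\<And>y. y \<in> set_pmf D \<Longrightarrow> q * X y \<le> m"
    and m: "0 < m" and q: "0 < q" and t: "0 \<le> t"
  shows "s * q * measure_pmf.prob D F \<le> measure_pmf.prob D {y. X y \<ge> t * m}"
proof -
  let ?P = "measure_pmf.prob D" and ?E = "measure_pmf.expectation D"
  let ?U = "{y. X y \<ge> t * m}"
  note [simp] = integrable_measure_pmf_finite[OF fin]
  have "(t + s) * m * ?P F \<le> ?E (\<lambda>y. indicator F y * X y)"
    unfolding cond_mean_mult_prob[OF fin F, symmetric] using mean by (intro mult_right_mono) auto
  also have "\<dots> \<le> ?E (\<lambda>y. t * m * indicator F y + m / q * indicator ?U y)"
  proof (rule expectation_mono_finite[OF fin])
    fix y assume "y \<in> set_pmf D"
    from X[OF this] have "X y \<le> m / q" using q by (simp add: field_simps)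
    moreover have "0 \<le> t * m" "0 \<le> m / q" using m q t by auto
    ultimately show "indicator F y * X y \<le> t * m * indicator F y + m / q * indicator ?U y"
      by (auto simp: indicator_def)
  qed
  also have "\<dots> = t * m * ?P F + m / q * ?P ?U" by simp
  finally have "m * (s * ?P F) \<le> m * (?P ?U / q)" by (simp add: algebra_simps)
  then have "s * ?P F \<le> ?P ?U / q" using m by (rule mult_left_le_imp_le)
  then show ?thesis using q by (simp add: field_simps)
qed

lemma power_one_minus_le_exp:
  fixes a :: real
  assumes "a \<le> 1"
  shows "(1 - a) ^ l \<le> exp (- (a * real l))"
proof -
  have "(1 - a) ^ l \<le> exp (- a) ^ l"
    using assms exp_ge_add_one_self[of "- a"] by (intro power_mono) auto
  then show ?thesis by (simp add: exp_of_nat_mult[symmetric] mult.commute)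
qed

text \<open>The ratio is \<open>1 - a\<close> with \<open>a = \<epsilon> / (1 + \<delta>)\<close>,
  and the factor 3 in \<open>K\<close> provides an exponent of about \<open>3 * \<phi>\<close>: two
  thirds give \<open>exp (- 2 * \<phi>)\<close>, the rest pays for the constant and for
  rounding.\<close>

lemma ratio_power_le:
  fixes \<epsilon> \<delta> K \<phi> :: real and d :: nat
  assumes d: "0 < d" and \<epsilon>: "0 < \<epsilon>" "\<epsilon> < 1 / 2" and \<delta>: "0 < \<delta>"
    and K: "3 * d * (1 + \<delta>) / \<epsilon> \<le> K"
    and \<phi>: "ln ((1 + \<epsilon>) / \<epsilon>\<^sup>2) + 1 \<le> \<phi>" "0 \<le> \<phi>"
  shows "((1 + \<delta> - \<epsilon>) / (1 + \<delta>)) ^ nat \<lfloor>K * \<phi> / d\<rfloor> \<le> \<epsilon>\<^sup>2 / (1 + \<epsilon>) * exp (- 2 * \<phi>)"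
proof -
  define l where "l = nat \<lfloor>K * \<phi> / d\<rfloor>"
  define a where "a = \<epsilon> / (1 + \<delta>)"
  have a: "0 < a" "a \<le> 1" using \<epsilon> \<delta> by (auto simp: a_def)
  have "3 \<le> a * K / d"
    using K \<epsilon> \<delta> d by (simp add: a_def pos_le_divide_eq pos_divide_le_eq mult_ac)
  then have "3 * \<phi> \<le> a * K / d * \<phi>" using \<phi>(2) by (rule mult_right_mono)
  also have "\<dots> = a * (K * \<phi> / d)" by simp
  \<comment> \<open>The floor loses less than 1, and \<open>a \<le> 1\<close> keeps the loss below
    the \<open>+ 1\<close> in the lower bound on \<open>\<phi>\<close>.\<close>
  also have "\<dots> \<le> a * (real l + 1)"
    using a unfolding l_def by (intro mult_left_mono) linarith+
  also have "\<dots> \<le> a * l + 1" using a by (simp add: algebra_simps)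
  finally have le: "- (a * l) \<le> - ln ((1 + \<epsilon>) / \<epsilon>\<^sup>2) + - 2 * \<phi>" using \<phi>(1) by linarith
  have "(1 + \<delta> - \<epsilon>) / (1 + \<delta>) = 1 - a" using \<delta> by (simp add: a_def field_simps)
  then have "((1 + \<delta> - \<epsilon>) / (1 + \<delta>)) ^ l \<le> exp (- (a * l))"
    using power_one_minus_le_exp[OF a(2)] by simp
  also have "\<dots> \<le> exp (- ln ((1 + \<epsilon>) / \<epsilon>\<^sup>2) + - 2 * \<phi>)" using le by simp
  also have "\<dots> = \<epsilon>\<^sup>2 / (1 + \<epsilon>) * exp (- 2 * \<phi>)"
    unfolding exp_add exp_minus[of "ln _"] using \<epsilon> by simp
  finally show ?thesis unfolding l_def .
qed

section \<open>The main estimate\<close>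

text \<open>With \<open>\<phi>\<close> the value of \<open>Phi\<close> at
  \<open>\<delta> + \<epsilon>\<close>, when finite, the three bounds on \<open>K\<close> serve in
  turn to get \<open>exp (- \<phi>) \<le> p ^ d\<close>, to make the moment bound decay fast enough,
  and to make \<open>\<phi>\<close> exceed a constant.\<close>

lemma upper_tail_le:
  fixes d N :: nat and \<epsilon> \<delta> p K :: real and X :: "(nat \<Rightarrow> bool) \<Rightarrow> real"
  defines "Y \<equiv> bernoulli_cube N p"
  defines "\<mu> \<equiv> measure_pmf.expectation Y X"
  defines "\<F> \<equiv> {F \<in> subcubes N.
              cond_mean Y F X \<ge> (1 + \<delta> - \<epsilon>) * \<mu> \<and>
              ereal (real (codim N F)) \<le> ereal K * Phi N Y X (\<delta> + \<epsilon>)}"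
  assumes d: "0 < d" and \<epsilon>: "0 < \<epsilon>" "\<epsilon> < 1 / 2" and \<delta>: "0 < \<delta>"
    and K: "real d \<le> K" "3 * d * (1 + \<delta>) / \<epsilon> \<le> K" "2 * (ln ((1 + \<epsilon>) / \<epsilon>\<^sup>2) + 1) \<le> K"
    and p: "0 < p" "p < 1 / 2"
    and nn: "\<And>y. y \<in> cube N \<Longrightarrow> 0 \<le> X y" and dX: "complexity N X \<le> d"
    and Phi: "Phi N Y X (\<delta> - \<epsilon>) \<ge> ereal (K * ln (1 / p))"
  shows "measure_pmf.prob Y {y. X y \<ge> (1 + \<delta>) * \<mu>}
         \<le> (1 + \<epsilon>) * measure_pmf.prob Y {y. \<exists>F \<in> \<F>. y \<in> F}"
proof -
  let ?P = "measure_pmf.prob Y"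
  define B where "B = {y. \<exists>F \<in> \<F>. y \<in> F}"
  define U where "U = {y. X y \<ge> (1 + \<delta>) * \<mu>}"
  have S: "set_pmf Y = cube N" unfolding Y_def using p by (intro set_pmf_bernoulli_cube) auto
  then have fin: "finite (set_pmf Y)" by (simp add: finite_cube)
  have \<mu>0: "0 \<le> \<mu>"
    unfolding \<mu>_def using nn S by (intro integral_nonneg_AE) (auto simp: AE_measure_pmf_iff)
  have K0: "0 < K" using K(1) d by simp
  have lnp: "0 < ln (1 / p)" using p by (intro ln_gt_zero) (simp add: field_simps)
  have prob_cube: "?P (cube N) = 1"
    using S measure_pmf.prob_eq_1[of "cube N" Y] by (simp add: AE_measure_pmf_iff)
  have pos: "0 < ?P F" if "F \<in> subcubes N" for F
    unfolding Y_def using p that by (rule prob_subcube_pos)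
  \<comment> \<open>Were the mean zero, the whole cube would compete in \<open>Phi\<close> and force
    it down to 0, against the lower bound \<open>K * ln (1 / p) > 0\<close>.\<close>
  have \<mu>: "0 < \<mu>"
  proof (rule ccontr)
    assume "\<not> 0 < \<mu>"
    with \<mu>0 have "\<mu> = 0" by simp
    moreover have "0 \<le> cond_mean Y (cube N) X"
      using cond_mean_mult_prob[OF fin, of "cube N" X] prob_cube nn S
      by (auto simp: AE_measure_pmf_iff intro!: integral_nonneg_AE)
    ultimately have "Phi N Y X (\<delta> - \<epsilon>) \<le> ereal (- ln (?P (cube N)))"
      using pos[OF cube_in_subcubes] by (intro Phi_le cube_in_subcubes) (auto simp: \<mu>_def)
    also have "\<dots> = 0" by (simp add: prob_cube)
    finally have "ereal (K * ln (1 / p)) \<le> 0" using Phi by (rule order_trans[rotated])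
    with mult_pos_pos[OF K0 lnp] show False by (simp add: zero_ereal_def)
  qed
  have Phi2: "ereal (K * ln (1 / p)) \<le> Phi N Y X (\<delta> + \<epsilon>)"
    using Phi Phi_mono[of "\<delta> - \<epsilon>" "\<delta> + \<epsilon>" Y X N] \<epsilon> \<mu>0 unfolding \<mu>_def by auto
  show ?thesis
  \<comment> \<open>In the infinite case the codimension condition is vacuous, and each point of the
    tail event forms by itself a member of \<open>\<F>\<close>.\<close>
  proof (cases "Phi N Y X (\<delta> + \<epsilon>) = \<infinity>")
    case True
    have "y \<in> B" if y: "y \<in> cube N" "y \<in> U" for y
    proof -
      have "X y * ?P {y} = cond_mean Y {y} X * ?P {y}"
        unfolding cond_mean_mult_prob[OF fin pos[OF singleton_in_subcubes[OF y(1)]]]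
        by (subst integral_measure_pmf_real[of "{y}"]) (auto simp: indicator_def measure_pmf_single)
      then have "cond_mean Y {y} X = X y"
        using pos[OF singleton_in_subcubes[OF y(1)]] by simp
      moreover have "(1 + \<delta> - \<epsilon>) * \<mu> \<le> (1 + \<delta>) * \<mu>"
        using \<epsilon> \<mu> by (intro mult_right_mono) auto
      ultimately have "{y} \<in> \<F>"
        using y K0 True singleton_in_subcubes by (auto simp: \<F>_def U_def)
      then show ?thesis by (auto simp: B_def)
    qed
    then have "?P U \<le> ?P B"
      using S by (intro measure_pmf.finite_measure_mono_AE) (auto simp: AE_measure_pmf_iff)
    also have "\<dots> \<le> (1 + \<epsilon>) * ?P B" using \<epsilon> mult_right_mono[of 1 "1 + \<epsilon>" "?P B"] by simp
    finally show ?thesis by (simp add: U_def B_def)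
  next
    case False
    then obtain F where F: "F \<in> subcubes N" "?P F > 0"
        "cond_mean Y F X \<ge> (1 + (\<delta> + \<epsilon>)) * \<mu>"
        "Phi N Y X (\<delta> + \<epsilon>) = ereal (- ln (?P F))"
      unfolding \<mu>_def by (rule Phi_attained)
    define \<phi> where "\<phi> = - ln (?P F)"
    have PF: "?P F = exp (- \<phi>)" using F(2) by (simp add: \<phi>_def)
    have Pphi: "Phi N Y X (\<delta> + \<epsilon>) = ereal \<phi>" using F(4) by (simp add: \<phi>_def)
    have \<phi>K: "K * ln (1 / p) \<le> \<phi>" using Phi2 Pphi by simp
    have \<phi>0: "0 \<le> \<phi>" using \<phi>K mult_pos_pos[OF K0 lnp] by linarith
    have "ln 2 \<le> ln (1 / p)" using p by (intro ln_mono) (auto simp: field_simps)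
    then have "1 / 2 \<le> ln (1 / p)" using ln2_ge_two_thirds by linarith
    then have "K * (1 / 2) \<le> K * ln (1 / p)" using K0 by (intro mult_left_mono) auto
    also note \<phi>K
    finally have "K \<le> 2 * \<phi>" by simp
    with K(3) have "2 * (ln ((1 + \<epsilon>) / \<epsilon>\<^sup>2) + 1) \<le> 2 * \<phi>" by (rule order_trans)
    then have \<phi>1: "ln ((1 + \<epsilon>) / \<epsilon>\<^sup>2) + 1 \<le> \<phi>" by simp

    define T where "T = {F. F \<in> subcubes N \<and> codim N F \<le> complexity N X}"
    obtain c where c: "\<And>F. 0 \<le> c F"
        and X: "\<And>y. y \<in> cube N \<Longrightarrow> X y = (\<Sum>F\<in>T. c F * indicator F y)"
      using complexity_attained[of N X] nn unfolding T_def by blast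
    have T: "finite T" "T \<subseteq> subcubes N" and Td: "\<And>F. F \<in> T \<Longrightarrow> codim N F \<le> d"
      using dX by (auto simp: T_def finite_subcubes)

    have Xmax: "p ^ d * X y \<le> \<mu>" if "y \<in> set_pmf Y" for y
      using that S max_le_expectation[OF p T Td c X, of y]
      unfolding \<mu>_def Y_def by blast
    \<comment> \<open>This leads to \<open>exp (- \<phi>) \<le> p ^ d\<close>, so the loss
      \<open>p ^ d\<close> in the lower tail bound costs only a second factor
      \<open>exp (- \<phi>)\<close>.\<close>
    have "real d * ln (1 / p) \<le> K * ln (1 / p)" using K lnp by (intro mult_right_mono) auto
    also note \<phi>K
    finally have "- \<phi> \<le> d * ln p" using p by (simp add: ln_div)
    then have "exp (- \<phi>) \<le> exp (d * ln p)" by simp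
    also have "\<dots> = p ^ d" using p by (simp add: exp_of_nat_mult)
    finally have "\<epsilon> * exp (- \<phi>) * exp (- \<phi>) \<le> \<epsilon> * p ^ d * ?P F"
      unfolding PF using \<epsilon> by (intro mult_right_mono mult_left_mono) auto
    also have "\<dots> \<le> ?P U"
      unfolding U_def using F(3) \<mu> p \<delta>
      by (intro upper_tail_ge[OF fin F(2) _ Xmax]) (auto simp: algebra_simps)
    finally have lower: "\<epsilon> * exp (- 2 * \<phi>) \<le> ?P U"
      by (simp add: mult.assoc exp_add[symmetric])

    \<comment> \<open>The largest moment for which every subcube revealed in the expansion still
      meets the codimension condition of \<open>\<F>\<close>.\<close>
    define l where "l = nat \<lfloor>K * \<phi> / d\<rfloor>"
    have "0 \<le> K * \<phi> / d" using K0 \<phi>0 by simp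
    then have "real l \<le> K * \<phi> / d" unfolding l_def by linarith
    then have dl: "real (d * l) \<le> K * \<phi>" using d by (simp add: field_simps)
    have Bsub: "G \<subseteq> B" if "G \<in> subcubes N" "codim N G \<le> d * l" "0 < ?P G"
      "(1 + \<delta> - \<epsilon>) * \<mu> \<le> cond_mean Y G X" for G
    proof -
      have "real (codim N G) \<le> K * \<phi>" using that(2) dl by linarith
      then have "G \<in> \<F>" using that Pphi by (simp add: \<F>_def)
      then show ?thesis by (auto simp: B_def)
    qed
    have A0: "0 \<le> (1 + \<delta> - \<epsilon>) * \<mu>" using \<mu> \<epsilon> \<delta> by simp
    \<comment> \<open>Markov for the truncated moment; the expansion starts from the whole cube,
      which has codimension 0 and leaves the full budget \<open>d * l\<close>.\<close>
    have "((1 + \<delta>) * \<mu>) ^ l * ?P (U - B)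
        \<le> measure_pmf.expectation Y (\<lambda>y. indicator (cube N) y * X y ^ l * indicator (- B) y)"
      using fin nn S \<mu> \<delta>
      by (intro prob_mult_le_expectation) (auto simp: U_def indicator_def intro!: power_mono)
    also have "\<dots> \<le> ?P (cube N) * ((1 + \<delta> - \<epsilon>) * \<mu>) ^ l"
      using X S by (intro truncated_moment_le[OF fin T Td c _ A0 Bsub])
        (auto simp: cube_in_subcubes codim_cube)
    finally have "\<mu> ^ l * ((1 + \<delta>) ^ l * ?P (U - B)) \<le> \<mu> ^ l * (1 + \<delta> - \<epsilon>) ^ l"
      by (simp add: prob_cube power_mult_distrib mult_ac)
    then have "(1 + \<delta>) ^ l * ?P (U - B) \<le> (1 + \<delta> - \<epsilon>) ^ l"
      by (rule mult_left_le_imp_le) (use \<mu> in simp)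
    then have "?P (U - B) \<le> ((1 + \<delta> - \<epsilon>) / (1 + \<delta>)) ^ l"
      using \<delta> by (simp add: power_divide pos_le_divide_eq mult.commute)
    also have "\<dots> \<le> \<epsilon>\<^sup>2 / (1 + \<epsilon>) * exp (- 2 * \<phi>)"
      unfolding l_def using d \<epsilon> \<delta> K(2) \<phi>1 \<phi>0 by (rule ratio_power_le)
    \<comment> \<open>One \<open>\<epsilon>\<close> is spent on the lower bound for
      \<open>?P U\<close>; the remaining \<open>\<epsilon> / (1 + \<epsilon>)\<close> equals
      \<open>1 - 1 / (1 + \<epsilon>)\<close>, which yields exactly the factor
      \<open>1 + \<epsilon>\<close> at the end.\<close>
    also have "\<dots> = \<epsilon> / (1 + \<epsilon>) * (\<epsilon> * exp (- 2 * \<phi>))" by (simp add: power2_eq_square)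
    also have "\<dots> \<le> \<epsilon> / (1 + \<epsilon>) * ?P U" using lower \<epsilon> by (intro mult_left_mono) auto
    finally have small: "?P (U - B) \<le> \<epsilon> / (1 + \<epsilon>) * ?P U" .
    have "?P U \<le> ?P (B \<union> (U - B))" by (intro measure_pmf.finite_measure_mono) auto
    also have "\<dots> \<le> ?P B + ?P (U - B)" by (intro measure_Un_le) auto
    finally have "?P U \<le> ?P B + \<epsilon> / (1 + \<epsilon>) * ?P U" using small by linarith
    then have "?P U \<le> (1 + \<epsilon>) * ?P B" using \<epsilon> by (simp add: field_simps)
    then show ?thesis by (simp add: U_def B_def)
  qed
qed

theorem theorem2p1:
  fixes d :: nat and \<epsilon> \<delta> :: real
  assumes "0 < d" and "0 < \<epsilon>" and "\<epsilon> < 1 / 2" and "0 < \<delta>"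
  shows "\<exists>K::real. 0 < K \<and>
    (\<forall>(N::nat) (p::real) (X :: (nat \<Rightarrow> bool) \<Rightarrow> real) Y \<F>.
       0 < p \<longrightarrow> p < 1 / 2 \<longrightarrow>
       Y = bernoulli_cube N p \<longrightarrow>
       (\<forall>y \<in> cube N. 0 \<le> X y) \<longrightarrow>
       complexity N X \<le> d \<longrightarrow>
       Phi N Y X (\<delta> - \<epsilon>) \<ge> ereal (K * ln (1 / p)) \<longrightarrow>
       \<F> = {F \<in> subcubes N.
              cond_mean Y F X \<ge> (1 + \<delta> - \<epsilon>) * measure_pmf.expectation Y X \<and>
              ereal (real (codim N F)) \<le> ereal K * Phi N Y X (\<delta> + \<epsilon>)} \<longrightarrow>
       measure_pmf.prob Y {y. X y \<ge> (1 + \<delta>) * measure_pmf.expectation Y X}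
         \<le> (1 + \<epsilon>) * measure_pmf.prob Y {y. \<exists>F \<in> \<F>. y \<in> F})"
proof -
  define K where "K = Max {real d, 3 * d * (1 + \<delta>) / \<epsilon>, 2 * (ln ((1 + \<epsilon>) / \<epsilon>\<^sup>2) + 1)}"
  have K: "real d \<le> K" "3 * d * (1 + \<delta>) / \<epsilon> \<le> K" "2 * (ln ((1 + \<epsilon>) / \<epsilon>\<^sup>2) + 1) \<le> K"
    unfolding K_def by (intro Max_ge; simp)+
  show ?thesis
  proof (intro exI[of _ K] conjI allI impI)
    show "0 < K" using K(1) assms(1) by simp
  next
    fix N p X Y \<F>
    assume p: "0 < p" "p < 1 / 2" and Y: "Y = bernoulli_cube N p"
      and X: "\<forall>y \<in> cube N. 0 \<le> (X y :: real)" "complexity N X \<le> d"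
      and Phi: "Phi N Y X (\<delta> - \<epsilon>) \<ge> ereal (K * ln (1 / p))"
      and F: "\<F> = {F \<in> subcubes N.
              cond_mean Y F X \<ge> (1 + \<delta> - \<epsilon>) * measure_pmf.expectation Y X \<and>
              ereal (real (codim N F)) \<le> ereal K * Phi N Y X (\<delta> + \<epsilon>)}"
    show "measure_pmf.prob Y {y. X y \<ge> (1 + \<delta>) * measure_pmf.expectation Y X}
         \<le> (1 + \<epsilon>) * measure_pmf.prob Y {y. \<exists>F \<in> \<F>. y \<in> F}"
      unfolding F Y
      by (rule upper_tail_le[OF assms K p _ X(2) Phi[unfolded Y]]) (use X(1) in blast)
  qed
qed

end
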